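(* Let $S=(V,F)$ be a triangular mesh without boundary and let $X$ be a vector field on $S$. Let $\mathrm{Div}_A X$ be the discrete divergence of $X$, defined at the vertices and extended piecewise linearly (linearly on each triangle) to $S$. Then $$\int_S \mathrm{Div}_A X=0.$$
   Context: A triangular surface mesh $S=(V,F)$ in $\mathbb{R}^3$ has a finite list $V$ of vertices and a finite list $F$ of (consistently oriented) triangles; a vector field on $S$ assigns a vector $X(v)\in\mathbb{R}^3$ to each vertex $v$. Approximate normal: for $v\in V$, with $T(v)$ the set of triangles containing $v$, $N_T$ the unit normal of $T$, $G_T$ the centroid of $T$, $$\omega_T=\frac{\|G_T-v\|^{-2}}{\sum_{\tilde T\in T(v)}\|G_{\tilde T}-v\|^{-2}},\qquad N_A(v)=\frac{\sum_{T\in T(v)}\omega_T N_T}{\left\|\sum_{T\in T(v)}\omega_T N_T\right\|}.$$ Outer normals: for every $v\in V$, the neighboring vertices of $v$ are $v_0,\dots,v_n$ with $v_0=v_n$, labeled counterclockwise about $N_A(v)$ (i.e. their projections $(v_j-v)-\langle v_j-v,N_A(v)\rangle N_A(v)$ to the plane $N_A(v)^\perp$ form a polygon going once counterclockwise around the origin, consecutive ones spanning an angle in $(0,\pi)$), and $T_j$ is the triangle with vertices $v,v_j,v_{j+1}$. Let $w_1,w_2$ be the projections of $v_{j+1}-v_j$ and $v-v_j$ to the plane $N_A(v_j)^\perp$, i.e. $w_1=(v_{j+1}-v_j)-\langle v_{j+1}-v_j,N_A(v_j)\rangle N_A(v_j)$ and $w_2=(v-v_j)-\langle v-v_j,N_A(v_j)\rangle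 N_A(v_j)$, and $$n(T_j,v_j)=\frac{\langle w_2,w_1\rangle w_1-\|w_1\|^2w_2}{\left\|\langle w_2,w_1\rangle w_1-\|w_1\|^2w_2\right\|}.$$ Similarly, $n(T_j,v_{j+1})$ is given by the same formula with $w_1,w_2$ replaced by the projections $w_3,w_4$ of $v_j-v_{j+1}$ and $v-v_{j+1}$ to the plane $N_A(v_{j+1})^\perp$. All these expressions are assumed to be well defined (nonzero denominators). Discrete divergence, with $|T|$ the area of $T$: $$\mathrm{Div}_A X(v)=\frac{1}{\sum_{k=0}^{n-1}|T_k|}\sum_{j=0}^{n-1}\frac{\|v_{j+1}-v_j\|}{6}\Big(2\langle X(v_j),n(T_j,v_j)\rangle+2\langle X(v_{j+1}),n(T_j,v_{j+1})\rangle+\langle X(v_j),n(T_j,v_{j+1})\rangle+\langle X(v_{j+1}),n(T_j,v_j)\rangle\Big).$$ *)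

theory Defs
  imports "HOL-Analysis.Analysis"
begin

text \<open>A mesh is given by the list \<open>V\<close> of vertex positions and the list \<open>F\<close> of triangles.
  Vertices are referred to by their index in \<open>V\<close>, and a triangle is a triple of indices whose
  cyclic order is its orientation. Vertex functions (vector fields, divergences) are
  functions of the index; their values beyond \<open>length V\<close> are irrelevant.\<close>

type_synonym tri = "nat \<times> nat \<times> nat"

fun verts :: "tri \<Rightarrow> nat set" where
  "verts (a, b, c) = {a, b, c}"

fun directed_edges :: "tri \<Rightarrow> (nat \<times> nat) set" where
  "directed_edges (a, b, c) = {(a, b), (b, c), (c, a)}"

fun nondegenerate :: "(real^3) list \<Rightarrow> tri \<Rightarrow> bool" where
  "nondegenerate V (a, b, c) \<longleftrightarrow> \<not> collinear {V ! a, V ! b, V ! c}"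

text \<open>Consistent orientation: two distinct triangles never traverse a common edge in the same
  direction. In particular a triangle is listed only once, not also with its vertices rotated.\<close>

definition triangle_mesh :: "(real^3) list \<Rightarrow> tri list \<Rightarrow> bool" where
  "triangle_mesh V F \<longleftrightarrow>
     distinct F \<and>
     (\<forall>T\<in>set F. verts T \<subseteq> {..<length V} \<and> nondegenerate V T) \<and>
     (\<forall>T\<in>set F. \<forall>T'\<in>set F. T \<noteq> T' \<longrightarrow> directed_edges T \<inter> directed_edges T' = {})"

definition without_boundary :: "tri list \<Rightarrow> bool" where
  "without_boundary F \<longleftrightarrow>
     (\<forall>T\<in>set F. \<forall>(a, b)\<in>directed_edges T. card {T'\<in>set F. {a, b} \<subseteq> verts T'} = 2)"

definition star :: "tri list \<Rightarrow> nat \<Rightarrow> tri set" where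
  "star F v = {T\<in>set F. v \<in> verts T}"

definition neighbors :: "tri list \<Rightarrow> nat \<Rightarrow> nat set" where
  "neighbors F v = (\<Union>T\<in>star F v. verts T) - {v}"

definition area :: "real^3 \<Rightarrow> real^3 \<Rightarrow> real^3 \<Rightarrow> real" where
  "area a b c = norm (cross3 (b - a) (c - a)) / 2"

fun unit_normal :: "(real^3) list \<Rightarrow> tri \<Rightarrow> real^3" where
  "unit_normal V (a, b, c) = sgn (cross3 (V ! b - V ! a) (V ! c - V ! a))"

fun centroid :: "(real^3) list \<Rightarrow> tri \<Rightarrow> real^3" where
  "centroid V (a, b, c) = (1 / 3) *\<^sub>R (V ! a + V ! b + V ! c)"

definition weight :: "(real^3) list \<Rightarrow> tri list \<Rightarrow> nat \<Rightarrow> tri \<Rightarrow> real" where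
  "weight V F v T =
     inverse ((norm (centroid V T - V ! v))\<^sup>2) /
     (\<Sum>T'\<in>star F v. inverse ((norm (centroid V T' - V ! v))\<^sup>2))"

definition weighted_normal :: "(real^3) list \<Rightarrow> tri list \<Rightarrow> nat \<Rightarrow> real^3" where
  "weighted_normal V F v = (\<Sum>T\<in>star F v. weight V F v T *\<^sub>R unit_normal V T)"

definition N_A :: "(real^3) list \<Rightarrow> tri list \<Rightarrow> nat \<Rightarrow> real^3" where
  "N_A V F v = weighted_normal V F v /\<^sub>R norm (weighted_normal V F v)"

definition proj_perp :: "real^3 \<Rightarrow> real^3 \<Rightarrow> real^3" where
  "proj_perp N w = w - (w \<bullet> N) *\<^sub>R N"

text \<open>The points \<open>u 0, \<dots>, u n\<close> of the plane orthogonal to the unit vector \<open>N\<close>, with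
  \<open>u n = u 0\<close>, go once counterclockwise (right-hand rule about \<open>N\<close>) around the origin:
  their polar angles increase by steps in \<open>(0, pi)\<close> and by \<open>2 * pi\<close> in total.\<close>

definition once_ccw :: "real^3 \<Rightarrow> nat \<Rightarrow> (nat \<Rightarrow> real^3) \<Rightarrow> bool" where
  "once_ccw N n u \<longleftrightarrow>
     (\<exists>e\<^sub>1 e\<^sub>2 r \<theta>.
        norm e\<^sub>1 = 1 \<and> norm e\<^sub>2 = 1 \<and> e\<^sub>1 \<bullet> e\<^sub>2 = 0 \<and> cross3 e\<^sub>1 e\<^sub>2 = N \<and>
        (\<forall>j\<le>n. r j > 0 \<and> u j = r j *\<^sub>R (cos (\<theta> j) *\<^sub>R e\<^sub>1 + sin (\<theta> j) *\<^sub>R e\<^sub>2)) \<and>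
        (\<forall>j<n. 0 < \<theta> (Suc j) - \<theta> j \<and> \<theta> (Suc j) - \<theta> j < pi) \<and>
        \<theta> n = \<theta> 0 + 2 * pi)"

text \<open>\<open>d v\<close> is the number of neighbors of \<open>v\<close> and \<open>nb v 0, \<dots>, nb v (d v)\<close> is
  their closed counterclockwise labeling. It is unique up to a cyclic shift and is kept as
  a parameter.\<close>

definition ccw_labeling ::
  "(real^3) list \<Rightarrow> tri list \<Rightarrow> (nat \<Rightarrow> nat) \<Rightarrow> (nat \<Rightarrow> nat \<Rightarrow> nat) \<Rightarrow> bool" where
  "ccw_labeling V F d nb \<longleftrightarrow>
     (\<forall>v<length V.
        neighbors F v = nb v ` {..d v} \<and>
        nb v (d v) = nb v 0 \<and>
        (\<forall>j<d v. \<exists>T\<in>set F. verts T = {v, nb v j, nb v (Suc j)}) \<and>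
        once_ccw (N_A V F v) (d v) (\<lambda>j. proj_perp (N_A V F v) (V ! nb v j - V ! v)))"

text \<open>\<open>outer_normal V F v p q\<close> is the outer normal at \<open>p\<close> of the triangle \<open>v, p, q\<close> along the
  edge \<open>p, q\<close> opposite to \<open>v\<close>.\<close>

definition outer_vec :: "(real^3) list \<Rightarrow> tri list \<Rightarrow> nat \<Rightarrow> nat \<Rightarrow> nat \<Rightarrow> real^3" where
  "outer_vec V F v p q =
     (let w\<^sub>1 = proj_perp (N_A V F p) (V ! q - V ! p);
          w\<^sub>2 = proj_perp (N_A V F p) (V ! v - V ! p)
      in (w\<^sub>2 \<bullet> w\<^sub>1) *\<^sub>R w\<^sub>1 - (norm w\<^sub>1)\<^sup>2 *\<^sub>R w\<^sub>2)"

definition outer_normal :: "(real^3) list \<Rightarrow> tri list \<Rightarrow> nat \<Rightarrow> nat \<Rightarrow> nat \<Rightarrow> real^3" where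
  "outer_normal V F v p q = outer_vec V F v p q /\<^sub>R norm (outer_vec V F v p q)"

definition normals_well_defined ::
  "(real^3) list \<Rightarrow> tri list \<Rightarrow> (nat \<Rightarrow> nat) \<Rightarrow> (nat \<Rightarrow> nat \<Rightarrow> nat) \<Rightarrow> bool" where
  "normals_well_defined V F d nb \<longleftrightarrow>
     (\<forall>v<length V.
        weighted_normal V F v \<noteq> 0 \<and>
        (\<forall>j<d v. outer_vec V F v (nb v j) (nb v (Suc j)) \<noteq> 0 \<and>
                 outer_vec V F v (nb v (Suc j)) (nb v j) \<noteq> 0))"

definition Div_A ::
  "(real^3) list \<Rightarrow> tri list \<Rightarrow> (nat \<Rightarrow> nat) \<Rightarrow> (nat \<Rightarrow> nat \<Rightarrow> nat) \<Rightarrow> (nat \<Rightarrow> real^3) \<Rightarrow> nat \<Rightarrow> real" where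
  "Div_A V F d nb X v =
     1 / (\<Sum>k<d v. area (V ! v) (V ! nb v k) (V ! nb v (Suc k))) *
     (\<Sum>j<d v.
        let p = nb v j; q = nb v (Suc j);
            n\<^sub>p = outer_normal V F v p q; n\<^sub>q = outer_normal V F v q p
        in norm (V ! q - V ! p) / 6 *
           (2 * (X p \<bullet> n\<^sub>p) + 2 * (X q \<bullet> n\<^sub>q) + X p \<bullet> n\<^sub>q + X q \<bullet> n\<^sub>p))"

text \<open>The linear extension of a vertex function to each triangle, as a function of the point \<open>x\<close>
  of that triangle (well defined for nondegenerate triangles). Indexing by the triangle
  avoids assuming that different triangles meet only in common faces.\<close>

fun pl_extension :: "(real^3) list \<Rightarrow> (nat \<Rightarrow> real) \<Rightarrow> tri \<Rightarrow> real^3 \<Rightarrow> real" where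
  "pl_extension V f (a, b, c) x =
     (THE y. \<exists>\<alpha> \<beta> \<gamma>. 0 \<le> \<alpha> \<and> 0 \<le> \<beta> \<and> 0 \<le> \<gamma> \<and> \<alpha> + \<beta> + \<gamma> = 1 \<and>
        x = \<alpha> *\<^sub>R (V ! a) + \<beta> *\<^sub>R (V ! b) + \<gamma> *\<^sub>R (V ! c) \<and>
        y = \<alpha> * f a + \<beta> * f b + \<gamma> * f c)"

text \<open>Surface integral over a flat triangle, through its affine parametrization by the standard
  simplex; the norm of the cross product is the (constant) area element.\<close>

fun triangle_integral :: "(real^3) list \<Rightarrow> tri \<Rightarrow> (real^3 \<Rightarrow> real) \<Rightarrow> real" where
  "triangle_integral V (a, b, c) g =
     integral {(s::real, t::real). 0 \<le> s \<and> 0 \<le> t \<and> s + t \<le> 1}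
       (\<lambda>(s, t). g (V ! a + s *\<^sub>R (V ! b - V ! a) + t *\<^sub>R (V ! c - V ! a)) *
                 norm (cross3 (V ! b - V ! a) (V ! c - V ! a)))"

definition mesh_integral :: "(real^3) list \<Rightarrow> tri list \<Rightarrow> (tri \<Rightarrow> real^3 \<Rightarrow> real) \<Rightarrow> real" where
  "mesh_integral V F g = (\<Sum>T\<in>set F. triangle_integral V T (g T))"

end

theory Submission
  imports Defs
begin

text \<open>The integral of a piecewise linear function weights its value at \<open>v\<close> with a third of the
  area of the star of \<open>v\<close>, which cancels the denominator of the divergence. What remains is a
  sum of edge fluxes over all pairs of a triangle and one of its vertices \<open>v\<close>. Grouped by an
  endpoint \<open>p\<close> of the edge opposite to \<open>v\<close> instead, these fluxes cancel in pairs: if \<open>v\<close>, \<open>q\<close>,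
  \<open>v'\<close> are consecutive neighbors of \<open>p\<close>, the outer normals at \<open>p\<close> of the two triangles
  sharing the edge \<open>p, q\<close> are opposite, because \<open>v\<close> and \<open>v'\<close> are projected to different sides
  of \<open>q - p\<close>. That a star consists exactly of the triangles spanned by consecutive neighbors
  holds because a full turn in steps below \<open>pi\<close> needs at least three neighbors, so that the two
  labeled triangles at each edge are distinct and exhaust the two that the edge has.\<close>

section \<open>Integrals over the standard triangle\<close>

definition std_triangle :: "(real \<times> real) set" where
  "std_triangle = {(s, t). 0 \<le> s \<and> 0 \<le> t \<and> s + t \<le> 1}"

lemma compact_std_triangle: "compact std_triangle"
proof -
  have "closed std_triangle"
    unfolding std_triangle_def case_prod_unfold
    by (intro closed_Collect_conj closed_Collect_le continuous_intros)
  moreover have "std_triangle \<subseteq> cbox (0, 0) (1, 1)"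
    by (auto simp: std_triangle_def cbox_Pair_eq)
  ultimately show ?thesis
    using bounded_cbox bounded_subset compact_eq_bounded_closed by blast
qed

lemma integral_affine_std_triangle:
  fixes \<alpha> \<beta> \<gamma> :: real
  shows "integral std_triangle (\<lambda>(s, t). \<alpha> + \<beta> * s + \<gamma> * t) = (3 * \<alpha> + \<beta> + \<gamma>) / 6"
proof -
  define f where "f = (\<lambda>(s, t). \<alpha> + \<beta> * s + \<gamma> * t)"
  \<comment> \<open>Extension by zero turns the integral over the triangle into one over the plane,
    to which Fubini applies.\<close>
  define h where "h = (\<lambda>x. indicator std_triangle x *\<^sub>R f x)"
  have cont: "continuous_on std_triangle f"
    unfolding f_def case_prod_unfold by (intro continuous_intros)
  have int: "integrable lborel h"
    unfolding h_def by (rule borel_integrable_compact[OF compact_std_triangle cont])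
  have inner: "(LBINT t. h (s, t)) =
      indicator {0..1} s *\<^sub>R (\<alpha> * (1 - s) + \<beta> * s * (1 - s) + \<gamma> * (1 - s)\<^sup>2 / 2)" for s
  proof (cases "s \<in> {0..1}")
    case True
    have "(LBINT t. h (s, t)) = (LBINT t. indicator {0..1 - s} t *\<^sub>R (\<alpha> + \<beta> * s + \<gamma> * t))"
      using True by (intro Bochner_Integration.integral_cong)
        (auto simp: h_def f_def std_triangle_def indicator_def)
    also have "\<dots> = (\<alpha> * (1 - s) + \<beta> * s * (1 - s) + \<gamma> * (1 - s)\<^sup>2 / 2) - 0"
      using True
      by (intro integral_FTC_atLeastAtMost[where F = "\<lambda>t. \<alpha> * t + \<beta> * s * t + \<gamma> * t\<^sup>2 / 2",
            THEN trans])
         (auto intro!: continuous_intros derivative_eq_intros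
           simp flip: has_real_derivative_iff_has_vector_derivative)
    finally show ?thesis using True by simp
  next
    case False
    then have "h (s, t) = 0" for t
      by (auto simp: h_def std_triangle_def indicator_def)
    then show ?thesis using False by simp
  qed
  have "integral std_triangle f = (LBINT x:std_triangle. f x)"
    using int unfolding h_def
    by (intro set_borel_integral_eq_integral(2)[symmetric]) (simp add: set_integrable_def)
  also have "\<dots> = (LBINT x. h x)"
    by (simp add: set_lebesgue_integral_def h_def)
  also have "\<dots> = (LBINT s. LBINT t. h (s, t))"
    using int lborel_pair.integral_fst[of "\<lambda>s t. h (s, t)"] by (simp add: lborel_prod)
  also have "\<dots> = (LBINT s. indicator {0..1} s *\<^sub>R
      (\<alpha> * (1 - s) + \<beta> * s * (1 - s) + \<gamma> * (1 - s)\<^sup>2 / 2))"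
    by (simp add: inner)
  also have "\<dots> = (3 * \<alpha> + \<beta> + \<gamma>) / 6"
    by (rule integral_FTC_atLeastAtMost[where F = "\<lambda>s. \<alpha> * (s - s\<^sup>2 / 2) +
          \<beta> * (s\<^sup>2 / 2 - s ^ 3 / 3) - \<gamma> * (1 - s) ^ 3 / 6", THEN trans])
       (auto intro!: continuous_intros derivative_eq_intros
           simp flip: has_real_derivative_iff_has_vector_derivative
           simp: field_simps power2_eq_square power3_eq_cube)
  finally show ?thesis by (simp add: f_def)
qed

section \<open>Linear interpolation on a triangle\<close>

lemma noncollinear_barycentric_unique:
  fixes A B C :: "'a::euclidean_space"
  assumes "\<not> collinear {A, B, C}"
    and "\<alpha> + \<beta> + \<gamma> = 1" "\<alpha>' + \<beta>' + \<gamma>' = 1"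
    and "\<alpha> *\<^sub>R A + \<beta> *\<^sub>R B + \<gamma> *\<^sub>R C = \<alpha>' *\<^sub>R A + \<beta>' *\<^sub>R B + \<gamma>' *\<^sub>R C"
  shows "\<alpha> = \<alpha>' \<and> \<beta> = \<beta>' \<and> \<gamma> = \<gamma>'"
proof -
  define x y where "x = \<beta> - \<beta>'" and "y = \<gamma> - \<gamma>'"
  have \<alpha>: "\<alpha> = 1 - \<beta> - \<gamma>" "\<alpha>' = 1 - \<beta>' - \<gamma>'" using assms by auto
  have eq: "x *\<^sub>R (B - A) + y *\<^sub>R (C - A) = 0"
    using assms(4) unfolding \<alpha> x_def y_def by (simp add: algebra_simps)
  have nc: "\<not> collinear {0, B - A, C - A}" "\<not> collinear {0, C - A, B - A}"
    using assms(1) collinear_3[of B A C] by (simp_all add: insert_commute)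
  have "x = 0"
  proof (rule ccontr)
    assume "x \<noteq> 0"
    have "x *\<^sub>R (B - A) = x *\<^sub>R ((- y / x) *\<^sub>R (C - A))"
      using eq \<open>x \<noteq> 0\<close> by (simp add: add_eq_0_iff)
    then have "B - A = (- y / x) *\<^sub>R (C - A)"
      using \<open>x \<noteq> 0\<close> by (metis real_vector.scale_left_imp_eq)
    with nc(2) show False unfolding collinear_lemma by blast
  qed
  moreover have "y = 0"
    using eq nc \<open>x = 0\<close> by (auto simp: collinear_lemma)
  ultimately show ?thesis using \<alpha> by (simp add: x_def y_def)
qed

text \<open>The point has barycentric coordinates \<open>1 - s - t\<close>, \<open>s\<close>,
  \<open>t\<close>; their uniqueness determines the value of the \<open>THE\<close> term.\<close>

lemma pl_extension_eq:
  assumes "nondegenerate V (a, b, c)" "(s, t) \<in> std_triangle"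
  shows "pl_extension V f (a, b, c)
           (V ! a + s *\<^sub>R (V ! b - V ! a) + t *\<^sub>R (V ! c - V ! a)) =
         f a + (f b - f a) * s + (f c - f a) * t"
  unfolding pl_extension.simps
proof (rule the_equality, goal_cases)
  case 1
  show ?case
    using assms(2)
    by (intro exI[of _ "1 - s - t"] exI[of _ s] exI[of _ t])
       (auto simp: std_triangle_def algebra_simps)
next
  case (2 y)
  then obtain \<alpha> \<beta> \<gamma> where *: "\<alpha> + \<beta> + \<gamma> = 1" "y = \<alpha> * f a + \<beta> * f b + \<gamma> * f c"
    "V ! a + s *\<^sub>R (V ! b - V ! a) + t *\<^sub>R (V ! c - V ! a) =
       \<alpha> *\<^sub>R (V ! a) + \<beta> *\<^sub>R (V ! b) + \<gamma> *\<^sub>R (V ! c)"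
    by blast
  have "(1 - s - t) *\<^sub>R (V ! a) + s *\<^sub>R (V ! b) + t *\<^sub>R (V ! c) =
      \<alpha> *\<^sub>R (V ! a) + \<beta> *\<^sub>R (V ! b) + \<gamma> *\<^sub>R (V ! c)"
    using *(3) by (simp add: algebra_simps)
  then have "1 - s - t = \<alpha> \<and> s = \<beta> \<and> t = \<gamma>"
    using assms(1) *(1) by (intro noncollinear_barycentric_unique) auto
  then have \<alpha>: "\<alpha> = 1 - s - t" and "\<beta> = s" "\<gamma> = t" by auto
  then show ?case unfolding *(2) \<alpha> by (simp add: algebra_simps)
qed

text \<open>The Jacobian is twice the area, and \<open>3 * f a + (f b - f a) + (f c - f a)\<close>
  is the sum of the vertex values, so the integral is the area times their mean.\<close>

lemma triangle_integral_pl_extension: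
  assumes "nondegenerate V (a, b, c)"
  shows "triangle_integral V (a, b, c) (pl_extension V f (a, b, c)) =
         area (V ! a) (V ! b) (V ! c) * (f a + f b + f c) / 3"
proof -
  let ?J = "norm (cross3 (V ! b - V ! a) (V ! c - V ! a))"
  have "triangle_integral V (a, b, c) (pl_extension V f (a, b, c)) =
      integral std_triangle (\<lambda>(s, t). f a * ?J + (f b - f a) * ?J * s + (f c - f a) * ?J * t)"
    unfolding triangle_integral.simps std_triangle_def[symmetric]
    by (rule integral_cong)
       (clarsimp simp: pl_extension_eq[OF assms] simp del: pl_extension.simps,
        simp add: algebra_simps)
  then show ?thesis
    unfolding integral_affine_std_triangle area_def by (simp add: field_simps)
qed

text \<open>With \<open>area_swap\<close> this generates all permutations of the vertices; labels
  need not follow the order stored in a triangle.\<close>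

lemma area_rotate: "area b c a = area a b c"
proof -
  have "cross3 (c - b) (a - b) = cross3 (b - a) (c - a)"
    by (simp add: cross3_simps)
  then show ?thesis by (simp add: area_def)
qed

lemma area_swap: "area a c b = area a b c"
  by (metis area_def cross_skew norm_minus_cancel)

lemma area_pos: "\<not> collinear {a, b, c} \<Longrightarrow> 0 < area a b c"
  using collinear_3[of b a c]
  by (simp add: area_def cross_eq_0 insert_commute)

section \<open>Labelings and outer normals\<close>

text \<open>One or two steps below \<open>pi\<close> cannot add up to \<open>2 * pi\<close>. For
  injectivity, the angles at distinct indices below \<open>n\<close> differ by less than a full
  turn.\<close>

lemma once_ccw_labels:
  assumes "once_ccw N n u"
  shows "3 \<le> n" "inj_on u {..<n}"
proof -
  obtain e1 e2 :: "real^3" and r \<theta> where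
    e: "norm e1 = 1" "norm e2 = 1" "e1 \<bullet> e2 = 0"
    and u: "\<And>j. j \<le> n \<Longrightarrow> r j > 0 \<and> u j = r j *\<^sub>R (cos (\<theta> j) *\<^sub>R e1 + sin (\<theta> j) *\<^sub>R e2)"
    and step: "\<And>j. j < n \<Longrightarrow> 0 < \<theta> (Suc j) - \<theta> j \<and> \<theta> (Suc j) - \<theta> j < pi"
    and last: "\<theta> n = \<theta> 0 + 2 * pi"
    using assms unfolding once_ccw_def by metis
  show "3 \<le> n"
  proof (rule ccontr)
    assume "\<not> 3 \<le> n"
    then consider "n = 0" | "n = 1" | "n = 2" by linarith
    then show False
      using last step[of 0] step[of 1] pi_gt_zero
      by cases (auto simp: numeral_2_eq_2)
  qed
  have incr: "\<theta> j < \<theta> k" if "j < k" "k \<le> n" for j k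
    using that
  proof (induction k)
    case (Suc k)
    then show ?case using step[of k] by (cases "j = k") auto
  qed simp
  have ne: "u j \<noteq> u k" if "j < k" "k < n" for j k
  proof
    assume eq: "u j = u k"
    have ee: "e1 \<bullet> e1 = 1" "e2 \<bullet> e2 = 1" "e2 \<bullet> e1 = 0"
      using e by (auto simp: norm_eq_1 inner_commute)
    have "u i \<bullet> e1 = r i * cos (\<theta> i)" "u i \<bullet> e2 = r i * sin (\<theta> i)" if "i \<le> n" for i
      using u[OF that] e ee by (auto simp: algebra_simps inner_add_left)
    then have c: "r j * cos (\<theta> j) = r k * cos (\<theta> k)" and s: "r j * sin (\<theta> j) = r k * sin (\<theta> k)"
      using eq that by (metis less_imp_le less_trans)+
    have "(r i)\<^sup>2 = (r i * cos (\<theta> i))\<^sup>2 + (r i * sin (\<theta> i))\<^sup>2" for i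
      by (simp add: power_mult_distrib flip: distrib_left)
    then have "(r j)\<^sup>2 = (r k)\<^sup>2" using c s by metis
    then have "r j = r k" "r k > 0"
      using u[of j] u[of k] that by (auto simp: power2_eq_iff)
    then have "cos (\<theta> k) = cos (\<theta> j)" "sin (\<theta> k) = sin (\<theta> j)" using c s by auto
    then obtain m :: int where m: "\<theta> k = \<theta> j + 2 * pi * m"
      using sin_cos_eq_iff by metis
    have "\<theta> 0 \<le> \<theta> j" using incr[of 0 j] that by (cases "j = 0") auto
    then have "0 < 2 * pi * m" "2 * pi * m < 2 * pi * 1"
      using m incr[of j k] incr[of k n] last that by linarith+
    then have "0 < m" "m < 1"
      by (simp_all only: zero_less_mult_iff mult_less_cancel_left_pos) auto
    then show False by simp
  qed
  show "inj_on u {..<n}"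
    by (rule linorder_inj_onI') (use ne in auto)
qed

text \<open>In polar coordinates of the tangent plane at \<open>p\<close>, the outer normal is the direction of
  \<open>q - p\<close> turned by a right angle, away from \<open>v\<close>.\<close>

lemma outer_normal_polar:
  assumes e: "norm e1 = 1" "norm e2 = 1" "e1 \<bullet> e2 = 0"
    and q: "proj_perp (N_A V F p) (V ! q - V ! p) = r *\<^sub>R (cos a *\<^sub>R e1 + sin a *\<^sub>R e2)"
    and v: "proj_perp (N_A V F p) (V ! v - V ! p) = r' *\<^sub>R (cos b *\<^sub>R e1 + sin b *\<^sub>R e2)"
    and pos: "r > 0" "r' > 0"
  shows "outer_normal V F v p q = sgn (sin (a - b)) *\<^sub>R (cos a *\<^sub>R e2 - sin a *\<^sub>R e1)"
proof -
  let ?n = "cos a *\<^sub>R e2 - sin a *\<^sub>R e1"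
  let ?c = "cos a *\<^sub>R e1 + sin a *\<^sub>R e2"
  have ee: "e1 \<bullet> e1 = 1" "e2 \<bullet> e2 = 1" "e2 \<bullet> e1 = 0"
    using e by (auto simp: norm_eq_1 inner_commute)
  have dot: "(cos b *\<^sub>R e1 + sin b *\<^sub>R e2) \<bullet> ?c = cos (a - b)" for b
    using ee e by (simp add: inner_add_left inner_add_right cos_diff)
  have nrm: "?n \<bullet> ?n = 1" "(norm ?c)\<^sup>2 = 1"
    using ee e dot[of a] sin_cos_squared_add3[of a]
    by (auto simp: inner_diff_left inner_diff_right power2_norm_eq_inner)
  \<comment> \<open>The unit vector at angle \<open>b\<close> differs from its projection to
    \<open>?c\<close> by a multiple of \<open>?n\<close>; the sign of the factor tells on which side
    \<open>v\<close> lies.\<close>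
  have turn: "cos (a - b) *\<^sub>R ?c - (cos b *\<^sub>R e1 + sin b *\<^sub>R e2) = sin (a - b) *\<^sub>R ?n"
  proof -
    have "cos b = cos (a - (a - b))" "sin b = sin (a - (a - b))" by simp_all
    then have "cos b = cos a * cos (a - b) + sin a * sin (a - b)"
      "sin b = sin a * cos (a - b) - cos a * sin (a - b)"
      unfolding cos_diff[of a "a - b"] sin_diff[of a "a - b"] by simp_all
    then have "cos a * cos (a - b) - cos b = - (sin a * sin (a - b))"
      "sin a * cos (a - b) - sin b = cos a * sin (a - b)" by linarith+
    moreover have "cos (a - b) *\<^sub>R ?c - (cos b *\<^sub>R e1 + sin b *\<^sub>R e2) =
        (cos a * cos (a - b) - cos b) *\<^sub>R e1 + (sin a * cos (a - b) - sin b) *\<^sub>R e2"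
      by (simp add: scaleR_diff_left scaleR_add_right mult.commute)
    ultimately show ?thesis
      by (simp add: scaleR_diff_right mult.commute)
  qed
  have "outer_vec V F v p q = (r\<^sup>2 * r') *\<^sub>R (cos (a - b) *\<^sub>R ?c - (cos b *\<^sub>R e1 + sin b *\<^sub>R e2))"
    unfolding outer_vec_def Let_def q v inner_scaleR_left inner_scaleR_right dot norm_scaleR
      power_mult_distrib nrm(2)
    by (simp add: scaleR_diff_right power2_eq_square ac_simps)
  then have *: "outer_vec V F v p q = (r\<^sup>2 * r' * sin (a - b)) *\<^sub>R ?n"
    unfolding turn by simp
  have "norm ?n = 1" using nrm(1) by (simp add: norm_eq_1)
  then show ?thesis
    using pos unfolding outer_normal_def sgn_div_norm[symmetric] * sgn_scaleR
    by (simp add: sgn_mult) (simp add: sgn_div_norm)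
qed

text \<open>Cyclic successor on \<open>{..<n}\<close>. In a closed labeling \<open>Suc j\<close> may
  be \<open>n\<close>, a second index of the first vertex; injectivity and reindexing need the one
  below \<open>n\<close>.\<close>

definition next_index :: "nat \<Rightarrow> nat \<Rightarrow> nat" where
  "next_index n j = Suc j mod n"

lemma next_index_cases:
  "j < n \<Longrightarrow> Suc j < n \<and> next_index n j = Suc j \<or> Suc j = n \<and> next_index n j = 0"
  by (cases "Suc j = n") (auto simp: next_index_def)

lemma bij_betw_next_index: "bij_betw (next_index n) {..<n} {..<n}"
proof -
  have "inj_on (next_index n) {..<n}"
  proof (rule inj_onI)
    fix j k assume "j \<in> {..<n}" "k \<in> {..<n}" "next_index n j = next_index n k"
    then show "j = k" using next_index_cases[of j n] next_index_cases[of k n] by auto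
  qed
  moreover have "next_index n ` {..<n} \<subseteq> {..<n}"
    by (auto simp: next_index_def)
  ultimately show ?thesis
    by (simp add: bij_betw_def endo_inj_surj)
qed

text \<open>The direction of \<open>f k\<close> is less than \<open>pi\<close> past that of
  \<open>f j\<close> and less than \<open>pi\<close> before that of \<open>f (Suc k)\<close>, so the
  sines in \<open>outer_normal_polar\<close> have opposite signs.\<close>

lemma outer_normals_cancel:
  assumes ccw: "once_ccw (N_A V F p) n (\<lambda>j. proj_perp (N_A V F p) (V ! f j - V ! p))"
    and closed: "f n = f 0" and j: "j < n" and k: "k = next_index n j"
  shows "outer_normal V F (f j) p (f k) = - outer_normal V F (f (Suc k)) p (f k)"
proof -
  obtain e1 e2 :: "real^3" and r \<theta> where
    e: "norm e1 = 1" "norm e2 = 1" "e1 \<bullet> e2 = 0"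
    and u: "\<And>j. j \<le> n \<Longrightarrow> r j > 0 \<and> proj_perp (N_A V F p) (V ! f j - V ! p)
              = r j *\<^sub>R (cos (\<theta> j) *\<^sub>R e1 + sin (\<theta> j) *\<^sub>R e2)"
    and step: "\<And>j. j < n \<Longrightarrow> 0 < \<theta> (Suc j) - \<theta> j \<and> \<theta> (Suc j) - \<theta> j < pi"
    and last: "\<theta> n = \<theta> 0 + 2 * pi"
    using ccw unfolding once_ccw_def by metis
  \<comment> \<open>At the wrap-around \<open>k = 0\<close> the angles
    \<open>\<theta> (Suc j)\<close> and \<open>\<theta> k\<close> differ by a full turn, so only
    sine and cosine are identified.\<close>
  have k': "k < n" and fk: "f (Suc j) = f k"
    and trig: "cos (\<theta> (Suc j)) = cos (\<theta> k)" "sin (\<theta> (Suc j)) = sin (\<theta> k)"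
    using next_index_cases[OF j] closed j last by (auto simp: k)
  have "outer_normal V F (f j) p (f (Suc j)) =
      sgn (sin (\<theta> (Suc j) - \<theta> j)) *\<^sub>R (cos (\<theta> (Suc j)) *\<^sub>R e2 - sin (\<theta> (Suc j)) *\<^sub>R e1)"
    using u[of j] u[of "Suc j"] j e by (intro outer_normal_polar) auto
  also have "sgn (sin (\<theta> (Suc j) - \<theta> j)) = 1"
    using step[OF j] by (simp add: sin_gt_zero)
  finally have 1: "outer_normal V F (f j) p (f k) = cos (\<theta> k) *\<^sub>R e2 - sin (\<theta> k) *\<^sub>R e1"
    using trig fk by simp
  have "outer_normal V F (f (Suc k)) p (f k) =
      sgn (sin (\<theta> k - \<theta> (Suc k))) *\<^sub>R (cos (\<theta> k) *\<^sub>R e2 - sin (\<theta> k) *\<^sub>R e1)"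
    using u[of k] u[of "Suc k"] k' e by (intro outer_normal_polar) auto
  also have "sgn (sin (\<theta> k - \<theta> (Suc k))) = -1"
  proof -
    have "sin (\<theta> k - \<theta> (Suc k)) = - sin (\<theta> (Suc k) - \<theta> k)"
      by (metis minus_diff_eq sin_minus)
    then show ?thesis using step[OF k'] by (simp add: sin_gt_zero)
  qed
  finally show ?thesis using 1 by simp
qed

section \<open>Closed meshes with labeled vertex stars\<close>

locale labeled_mesh =
  fixes V :: "(real^3) list" and F :: "tri list"
    and d :: "nat \<Rightarrow> nat" and nb :: "nat \<Rightarrow> nat \<Rightarrow> nat"
  assumes mesh: "triangle_mesh V F"
    and closed: "without_boundary F"
    and labeling: "ccw_labeling V F d nb"
begin

text \<open>Each triangle at \<open>v\<close> gives both orders of its opposite edge. The condition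
  is symmetric in \<open>v\<close>, \<open>p\<close>, \<open>q\<close>, which permits regrouping
  around \<open>p\<close>.\<close>

definition faces_at :: "nat \<Rightarrow> (nat \<times> nat) set" where
  "faces_at v = {(p, q). \<exists>T\<in>set F. verts T = {v, p, q}}"

lemma triangle_noncollinear:
  assumes "T \<in> set F" "verts T = {a, b, c}"
  shows "\<not> collinear {V ! a, V ! b, V ! c}"
proof -
  obtain x y z where T: "T = (x, y, z)" by (cases T)
  have "\<not> collinear ((!) V ` verts T)"
    using mesh assms(1) unfolding triangle_mesh_def T by force
  then show ?thesis unfolding assms(2) by simp
qed

lemma triangle_distinct:
  assumes "T \<in> set F" "verts T = {a, b, c}"
  shows "a \<noteq> b" "b \<noteq> c" "a \<noteq> c"
  using triangle_noncollinear[OF assms] by (auto simp: collinear_2 insert_commute)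

lemma verts_less_length: "T \<in> set F \<Longrightarrow> v \<in> verts T \<Longrightarrow> v < length V"
  using mesh unfolding triangle_mesh_def by blast

text \<open>Two distinct vertices of a triangle form a directed edge in one of the two directions,
  and the count in \<open>without_boundary\<close> ignores the direction.\<close>

lemma card_triangles_edge:
  assumes "T \<in> set F" "a \<in> verts T" "b \<in> verts T" "a \<noteq> b"
  shows "card {T'\<in>set F. {a, b} \<subseteq> verts T'} = 2"
proof -
  have "(a, b) \<in> directed_edges T \<or> (b, a) \<in> directed_edges T"
    using assms(2-) by (cases T) auto
  then show ?thesis
    using closed assms(1) unfolding without_boundary_def by (fastforce simp: insert_commute)
qed

section \<open>The star of a single vertex\<close>

context
  fixes v assumes v: "v < length V"
begin

lemma ccw: "once_ccw (N_A V F v) (d v) (\<lambda>j. proj_perp (N_A V F v) (V ! nb v j - V ! v))"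
  and nb_closed: "nb v (d v) = nb v 0"
  and nb_neighbors: "neighbors F v = nb v ` {..d v}"
  using labeling v unfolding ccw_labeling_def by auto

lemma labeled_triangle: "j < d v \<Longrightarrow> \<exists>T\<in>set F. verts T = {v, nb v j, nb v (Suc j)}"
  using labeling v unfolding ccw_labeling_def by auto

lemma three_le_d: "3 \<le> d v"
  using once_ccw_labels(1)[OF ccw] .

lemma inj_on_nb: "inj_on (nb v) {..<d v}"
  using once_ccw_labels(2)[OF ccw] by (auto simp: inj_on_def)

lemma nb_Suc: "j < d v \<Longrightarrow> nb v (Suc j) = nb v (next_index (d v) j)"
  using next_index_cases[of j "d v"] nb_closed by auto

lemma next_index_less: "next_index (d v) j < d v"
  using three_le_d by (simp add: next_index_def)

lemma nb_eq_iff: "j < d v \<Longrightarrow> k < d v \<Longrightarrow> nb v j = nb v k \<longleftrightarrow> j = k"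
  using inj_on_nb by (auto simp: inj_on_eq_iff)

lemma nb_Suc_Suc_neq:
  assumes "j < d v"
  shows "nb v (Suc (next_index (d v) j)) \<noteq> nb v j"
  using assms next_index_cases[OF assms] next_index_less[of j] three_le_d
    next_index_cases[OF next_index_less, of j]
  by (auto simp: nb_Suc nb_eq_iff next_index_less)

lemma nb_edge_not_reversed:
  assumes "j < d v" "k < d v"
  shows "\<not> (nb v j = nb v (Suc k) \<and> nb v (Suc j) = nb v k)"
  using assms nb_Suc_Suc_neq[of j] by (auto simp: nb_Suc nb_eq_iff next_index_less)

text \<open>The last vertex of \<open>T2\<close> is not a vertex of \<open>T1\<close>, so these are
  two distinct triangles at the edge, and the edge has only two.\<close>

lemma triangles_at_labeled_edge:
  assumes j: "j < d v"
    and T1: "T1 \<in> set F" "verts T1 = {v, nb v j, nb v (Suc j)}"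
    and T2: "T2 \<in> set F"
      "verts T2 = {v, nb v (next_index (d v) j), nb v (Suc (next_index (d v) j))}"
  shows "T1 \<noteq> T2" "{T\<in>set F. {v, nb v (Suc j)} \<subseteq> verts T} = {T1, T2}"
proof -
  let ?k = "next_index (d v) j"
  have "nb v (Suc ?k) \<notin> verts T1"
    using triangle_distinct(2,3)[OF T2] nb_Suc_Suc_neq[OF j]
    unfolding T1(2) nb_Suc[OF j] by (metis empty_iff insert_iff)
  then show "T1 \<noteq> T2" using T2 by auto
  have "card {T\<in>set F. {v, nb v (Suc j)} \<subseteq> verts T} = 2"
    using T1 triangle_distinct[OF T1] by (intro card_triangles_edge[of T1]) auto
  moreover have "{T1, T2} \<subseteq> {T\<in>set F. {v, nb v (Suc j)} \<subseteq> verts T}"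
    using T1 T2 nb_Suc[OF j] by auto
  ultimately show "{T\<in>set F. {v, nb v (Suc j)} \<subseteq> verts T} = {T1, T2}"
    using \<open>T1 \<noteq> T2\<close>
    by (intro card_seteq[symmetric]) (auto intro: card_ge_0_finite)
qed

text \<open>At the edge from \<open>v\<close> to \<open>nb v (Suc j)\<close>, \<open>T'\<close> can
  only be \<open>T\<close> or the next labeled triangle; the latter is excluded because
  \<open>T'\<close> also fits label \<open>j\<close>.\<close>

lemma labeled_triangle_unique:
  assumes j: "j < d v"
    and T: "T \<in> set F" "verts T = {v, nb v j, nb v (Suc j)}"
    and T': "T' \<in> set F" "verts T' = {v, nb v j, nb v (Suc j)}"
  shows "T = T'"
proof -
  obtain T2 where T2: "T2 \<in> set F"
      "verts T2 = {v, nb v (next_index (d v) j), nb v (Suc (next_index (d v) j))}"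
    using labeled_triangle[OF next_index_less] by blast
  have "T' \<in> {T, T2}"
    using triangles_at_labeled_edge(2)[OF j T T2] T' by auto
  then show ?thesis using triangles_at_labeled_edge(1)[OF j T' T2] by auto
qed

lemma star_labeled:
  assumes T: "T \<in> set F" "v \<in> verts T"
  obtains j where "j < d v" "verts T = {v, nb v j, nb v (Suc j)}"
proof -
  obtain x y z where xyz: "verts T = {x, y, z}" by (cases T) auto
  then obtain p where p: "p \<in> verts T" "p \<noteq> v"
    using triangle_distinct(1)[OF T(1) xyz] by (metis insertI1 insertI2)
  then have "p \<in> neighbors F v"
    using T unfolding neighbors_def star_def by blast
  then obtain i where i: "i \<le> d v" "p = nb v i"
    unfolding nb_neighbors by blast
  \<comment> \<open>A successor index matches the edge in \<open>triangles_at_labeled_edge\<close>;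
    for \<open>i = 0\<close> the closing label \<open>nb v (d v)\<close> serves.\<close>
  obtain j where j: "j < d v" "p = nb v (Suc j)"
  proof (cases i)
    case 0
    then show ?thesis using that[of "d v - 1"] i three_le_d nb_closed by simp
  next
    case (Suc j)
    then show ?thesis using that[of j] i by simp
  qed
  obtain T1 where T1: "T1 \<in> set F" "verts T1 = {v, nb v j, nb v (Suc j)}"
    using labeled_triangle[OF j(1)] by blast
  obtain T2 where T2: "T2 \<in> set F"
      "verts T2 = {v, nb v (next_index (d v) j), nb v (Suc (next_index (d v) j))}"
    using labeled_triangle[OF next_index_less] by blast
  have "T \<in> {T1, T2}"
    using triangles_at_labeled_edge(2)[OF j(1) T1 T2] T p j by auto
  then show ?thesis using that j(1) next_index_less T1 T2 by blast
qed

text \<open>The labeled triangles enumerate the star bijectively: all of it is labeled, and the edge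
  opposite to \<open>v\<close> determines the label.\<close>

lemma sum_star:
  assumes "\<And>T j. T \<in> set F \<Longrightarrow> verts T = {v, nb v j, nb v (Suc j)} \<Longrightarrow> g T = h j"
  shows "sum g (star F v) = sum h {..<d v}"
proof -
  obtain \<tau> where \<tau>: "\<And>j. j < d v \<Longrightarrow> \<tau> j \<in> set F \<and> verts (\<tau> j) = {v, nb v j, nb v (Suc j)}"
    using labeled_triangle by metis
  have "inj_on \<tau> {..<d v}"
  proof (rule inj_onI)
    fix j k assume jk: "j \<in> {..<d v}" "k \<in> {..<d v}" "\<tau> j = \<tau> k"
    then have *: "{v, nb v j, nb v (Suc j)} = {v, nb v k, nb v (Suc k)}"
      using \<tau> by (metis lessThan_iff)
    have "nb v i \<noteq> v" "nb v (Suc i) \<noteq> v" if "i < d v" for i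
      using \<tau>[OF that] triangle_distinct by metis+
    then have "{nb v j, nb v (Suc j)} = {nb v k, nb v (Suc k)}"
      using * jk(1,2) insert_ident[of v "{nb v j, nb v (Suc j)}" "{nb v k, nb v (Suc k)}"]
      by (metis empty_iff insert_iff lessThan_iff)
    then have "nb v j = nb v k \<or> nb v j = nb v (Suc k) \<and> nb v (Suc j) = nb v k"
      by (auto simp: doubleton_eq_iff)
    then show "j = k"
      using nb_edge_not_reversed[of j k] nb_eq_iff jk by auto
  qed
  moreover have "\<tau> ` {..<d v} = star F v"
  proof
    show "\<tau> ` {..<d v} \<subseteq> star F v" using \<tau> by (auto simp: star_def)
    show "star F v \<subseteq> \<tau> ` {..<d v}"
    proof
      fix T assume "T \<in> star F v"
      then have T: "T \<in> set F" "v \<in> verts T" by (auto simp: star_def)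
      then obtain j where j: "j < d v" "verts T = {v, nb v j, nb v (Suc j)}"
        using star_labeled by metis
      then show "T \<in> \<tau> ` {..<d v}"
        using labeled_triangle_unique[OF j(1) T(1) j(2)] \<tau> by blast
    qed
  qed
  ultimately have "bij_betw \<tau> {..<d v} (star F v)" by (simp add: bij_betw_def)
  then have "sum g (star F v) = (\<Sum>j<d v. g (\<tau> j))"
    by (simp add: sum.reindex_bij_betw)
  also have "\<dots> = sum h {..<d v}" using assms \<tau> by (intro sum.cong) auto
  finally show ?thesis .
qed

text \<open>The pairs in label order and the reversed pairs are disjoint families because no edge is
  labeled in both directions.\<close>

lemma sum_faces_at:
  "(\<Sum>(p, q)\<in>faces_at v. g p q) = (\<Sum>j<d v. g (nb v j) (nb v (Suc j)) + g (nb v (Suc j)) (nb v j))"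
proof -
  let ?f = "\<lambda>j. (nb v j, nb v (Suc j))" and ?b = "\<lambda>j. (nb v (Suc j), nb v j)"
  have "faces_at v = ?f ` {..<d v} \<union> ?b ` {..<d v}" (is "_ = ?R")
  proof
    show "faces_at v \<subseteq> ?R"
    proof clarify
      fix p q assume "(p, q) \<in> faces_at v" "(p, q) \<notin> ?b ` {..<d v}"
      then obtain T where T: "T \<in> set F" "verts T = {v, p, q}" by (auto simp: faces_at_def)
      then obtain j where j: "j < d v" "verts T = {v, nb v j, nb v (Suc j)}"
        using star_labeled[of T] by auto
      have "{p, q} = {nb v j, nb v (Suc j)}"
        using T(2) j(2) triangle_distinct[OF T] triangle_distinct[OF T(1) j(2)]
        by (subst insert_ident[symmetric, of v]) auto
      then show "(p, q) \<in> ?f ` {..<d v}"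
        using j \<open>(p, q) \<notin> _\<close> by (auto simp: doubleton_eq_iff)
    qed
    show "?R \<subseteq> faces_at v"
      using labeled_triangle by (auto simp: faces_at_def insert_commute)
  qed
  moreover have "?f ` {..<d v} \<inter> ?b ` {..<d v} = {}"
    using nb_edge_not_reversed by auto
  moreover have "inj_on ?f {..<d v}" "inj_on ?b {..<d v}"
    using inj_on_nb by (auto simp: inj_on_def)
  ultimately show ?thesis
    by (simp add: sum.union_disjoint sum.reindex sum.distrib)
qed

end

text \<open>The edge flux in the divergence at \<open>v\<close> is \<open>half_flux X v p q + half_flux X v q p\<close>. The
  split isolates the outer normal at \<open>p\<close>, so that the terms can be regrouped around \<open>p\<close>.\<close>

definition half_flux :: "(nat \<Rightarrow> real^3) \<Rightarrow> nat \<Rightarrow> nat \<Rightarrow> nat \<Rightarrow> real" where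
  "half_flux X v p q =
     norm (V ! q - V ! p) / 6 * ((2 *\<^sub>R X p + X q) \<bullet> outer_normal V F v p q)"

text \<open>Consecutive triangles around \<open>p\<close> share an edge \<open>p, q\<close>. Length
  and field values depend only on \<open>p\<close> and \<open>q\<close>, so opposite outer normals
  give opposite half fluxes.\<close>

lemma sum_half_flux_vertex:
  assumes p: "p < length V"
  shows "(\<Sum>(v, q)\<in>faces_at p. half_flux X v p q) = 0"
proof -
  let ?g = "\<lambda>j. half_flux X (nb p (Suc j)) p (nb p j)"
  have "half_flux X (nb p j) p (nb p (Suc j)) = - ?g (next_index (d p) j)" if "j < d p" for j
    using outer_normals_cancel[OF ccw[OF p] nb_closed[OF p] that refl] nb_Suc[OF p that]
    by (simp add: half_flux_def)
  then have "(\<Sum>j<d p. half_flux X (nb p j) p (nb p (Suc j))) =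
      - (\<Sum>j<d p. ?g (next_index (d p) j))"
    by (simp add: sum_negf)
  also have "(\<Sum>j<d p. ?g (next_index (d p) j)) = (\<Sum>j<d p. ?g j)"
    by (rule sum.reindex_bij_betw[OF bij_betw_next_index])
  finally show ?thesis
    by (simp add: sum_faces_at[OF p] sum.distrib)
qed

lemma faces_at_less:
  "(p, q) \<in> faces_at v \<Longrightarrow> v < length V \<and> p < length V \<and> q < length V"
  unfolding faces_at_def by (auto intro!: verts_less_length simp del: verts.simps)

lemma faces_at_commute: "(p, q) \<in> faces_at v \<longleftrightarrow> (v, q) \<in> faces_at p"
  by (simp add: faces_at_def insert_commute)

lemma finite_faces_at: "finite (faces_at v)"
proof -
  have "faces_at v \<subseteq> {..<length V} \<times> {..<length V}"
    using faces_at_less by auto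
  then show ?thesis by (rule finite_subset) simp
qed

text \<open>Exchanging the roles of \<open>v\<close> and \<open>p\<close> collects the half fluxes
  with outer normal at \<open>p\<close>, which cancel for each \<open>p\<close>.\<close>

lemma sum_half_flux:
  "(\<Sum>v<length V. \<Sum>(p, q)\<in>faces_at v. half_flux X v p q) = 0"
proof -
  have "(\<Sum>v<length V. \<Sum>(p, q)\<in>faces_at v. half_flux X v p q) =
      (\<Sum>(v, p, q)\<in>Sigma {..<length V} faces_at. half_flux X v p q)"
    by (simp add: sum.Sigma finite_faces_at)
  also have "\<dots> = (\<Sum>(p, v, q)\<in>Sigma {..<length V} faces_at. half_flux X v p q)"
    by (rule sum.reindex_bij_witness[of _ "\<lambda>(p, v, q). (v, p, q)" "\<lambda>(v, p, q). (p, v, q)"])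
       (use faces_at_less faces_at_commute in \<open>auto simp del: verts.simps\<close>)
  also have "\<dots> = (\<Sum>p<length V. \<Sum>(v, q)\<in>faces_at p. half_flux X v p q)"
    by (simp add: sum.Sigma finite_faces_at)
  also have "\<dots> = 0" by (simp add: sum_half_flux_vertex)
  finally show ?thesis .
qed

text \<open>The four inner products are grouped by outer normal: the field counts twice at the base
  point of the normal and once at the other endpoint.\<close>

lemma Div_A_times_area:
  assumes v: "v < length V"
  shows "Div_A V F d nb X v * (\<Sum>j<d v. area (V ! v) (V ! nb v j) (V ! nb v (Suc j))) =
         (\<Sum>(p, q)\<in>faces_at v. half_flux X v p q)"
proof -
  \<comment> \<open>Positivity lets the denominator of \<open>Div_A\<close> cancel; division by zero
    would yield 0.\<close>
  have "0 < (\<Sum>j<d v. area (V ! v) (V ! nb v j) (V ! nb v (Suc j)))"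
    using three_le_d[OF v] labeled_triangle[OF v]
    by (intro sum_pos) (auto intro!: area_pos dest!: triangle_noncollinear simp: lessThan_empty_iff)
  then have "Div_A V F d nb X v * (\<Sum>j<d v. area (V ! v) (V ! nb v j) (V ! nb v (Suc j))) =
      (\<Sum>j<d v. half_flux X v (nb v j) (nb v (Suc j)) + half_flux X v (nb v (Suc j)) (nb v j))"
    unfolding Div_A_def half_flux_def Let_def inner_add_left inner_scaleR_left
      norm_minus_commute[of "V ! nb v j" "V ! nb v (Suc j)" for j]
    by (simp add: algebra_simps)
  then show ?thesis by (simp add: sum_faces_at[OF v])
qed

section \<open>Integrals of piecewise linear functions over the mesh\<close>

definition triangle_area :: "tri \<Rightarrow> real" where
  "triangle_area T = (case T of (a, b, c) \<Rightarrow> area (V ! a) (V ! b) (V ! c))"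

lemma triangle_area_eq:
  assumes "T \<in> set F" "verts T = {a, b, c}"
  shows "triangle_area T = area (V ! a) (V ! b) (V ! c)"
proof -
  obtain x y z where T: "T = (x, y, z)" by (cases T)
  have "{x, y, z} = {a, b, c}" using assms(2) T by simp
  then have "x \<in> {a, b, c}" "y \<in> {a, b, c}" "z \<in> {a, b, c}" by blast+
  moreover have "x \<noteq> y" "y \<noteq> z" "x \<noteq> z"
    using triangle_distinct[OF assms(1), of x y z] T by simp_all
  ultimately have
    "(x, y, z) \<in> {(a, b, c), (a, c, b), (b, a, c), (b, c, a), (c, a, b), (c, b, a)}"
    by auto
  then show ?thesis
    by (auto simp: T triangle_area_def) (metis area_rotate area_swap)+
qed

text \<open>Each triangle gives a third of its area to each of its vertex values. Exchanging the
  sums collects the area of the star of \<open>v\<close>, which \<open>sum_star\<close> rewrites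
  along the labels.\<close>

lemma mesh_integral_pl_extension:
  "mesh_integral V F (pl_extension V f) =
   (\<Sum>v<length V. f v * (\<Sum>j<d v. area (V ! v) (V ! nb v j) (V ! nb v (Suc j)))) / 3"
proof -
  have "triangle_integral V T (pl_extension V f T) =
      (\<Sum>v\<in>verts T. f v * triangle_area T) / 3" if "T \<in> set F" for T
  proof -
    obtain a b c where T: "T = (a, b, c)" by (cases T)
    have nd: "nondegenerate V (a, b, c)"
      using mesh that unfolding triangle_mesh_def T by blast
    have "a \<noteq> b" "b \<noteq> c" "a \<noteq> c" using triangle_distinct[OF that] T by auto
    then show ?thesis
      unfolding T triangle_integral_pl_extension[OF nd]
      by (simp add: triangle_area_def algebra_simps)
  qed
  then have "mesh_integral V F (pl_extension V f) =
      (\<Sum>T\<in>set F. \<Sum>v\<in>verts T. f v * triangle_area T) / 3"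
    by (simp add: mesh_integral_def sum_divide_distrib)
  also have "(\<Sum>T\<in>set F. \<Sum>v\<in>verts T. f v * triangle_area T) =
      (\<Sum>T\<in>set F. \<Sum>v | v \<in> {..<length V} \<and> v \<in> verts T. f v * triangle_area T)"
    using verts_less_length by (intro sum.cong refl) auto
  also have "\<dots> = (\<Sum>v<length V. \<Sum>T\<in>star F v. f v * triangle_area T)"
    unfolding star_def by (rule sum.swap_restrict) auto
  also have "\<dots> = (\<Sum>v<length V. f v * (\<Sum>j<d v. area (V ! v) (V ! nb v j) (V ! nb v (Suc j))))"
    unfolding sum_distrib_left[symmetric]
    by (intro sum.cong refl arg_cong2[where f = "(*)"] sum_star triangle_area_eq) auto
  finally show ?thesis .
qed

end

theorem theorem2:
  fixes V :: "(real^3) list"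
    and F :: "tri list"
    and d :: "nat \<Rightarrow> nat"
    and nb :: "nat \<Rightarrow> nat \<Rightarrow> nat"
    and X :: "nat \<Rightarrow> real^3"
  assumes "triangle_mesh V F"
    and "without_boundary F"
    and "ccw_labeling V F d nb"
    and "normals_well_defined V F d nb"
  shows "mesh_integral V F (pl_extension V (Div_A V F d nb X)) = 0"
proof -
  interpret labeled_mesh V F d nb
    using assms by unfold_locales
  show ?thesis
    by (simp add: mesh_integral_pl_extension Div_A_times_area sum_half_flux)
qed

end
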